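(* For any infinite chain $C$, the left diameter of the endomorphism monoid $\operatorname{End}(C)$ is $2$.
   Context: A chain is a totally ordered set. An endomorphism of a chain $C$ is an order-preserving map $\theta : C\to C$ (i.e. $x\le y$ implies $x\theta\le y\theta$). $\operatorname{End}(C)$ is the monoid of all endomorphisms of $C$ under composition; maps are written on the right of their arguments and composed left to right, so $x(\alpha\beta)=(x\alpha)\beta$. Left diameter of a monoid $S$. A left congruence on $S$ is an equivalence relation $\rho$ on $S$ such that $(a,b)\in\rho$ implies $(sa,sb)\in\rho$ for all $s\in S$. For $U\subseteq S\times S$, the left congruence generated by $U$ is the smallest left congruence containing $U$. For $a,b\in S$, a (left) $U$-sequence from $a$ to $b$ of length $n\in\mathbb{N}_0=\{0,1,2,\dots\}$ is a sequence of equalities $a=s_1u_1,\ s_1v_1=s_2u_2,\ \dots,\ s_nv_n=b$ where, for each $i\in\{1,\dots,n\}$, $s_i\in S$ and $(u_i,v_i)\in U$ or $(v_i,u_i)\in U$; for $n=0$ this is interpreted as $a=b$. The universal left congruence $\omega_S^l=S\times S$ is generated by $U$ if and only if any two elements of $S$ are connected by a left $U$-sequence; in that case let $d_U^l(a,b)$ be the least length of a left $U$-sequence from $a$ to $b$, and put $D_l(S;U)=\sup\{d_U^l(a,b): a,b\in S\}$. If $\omega_S^l$ is finitely generated, the left diameter of $S$ is $D_l(S)=\min\{D_l(S;U): U \text{ is a finite generating set of } \omega_S^l\}$. The assertion that the left diameter equals a given number includes the assertion that $\omega_S^l$ is finitely generated. *)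

theory Defs
  imports "HOL-Algebra.Group" "HOL-Library.Extended_Nat"
begin

definition left_congruence :: "('a, 'b) monoid_scheme \<Rightarrow> ('a \<times> 'a) set \<Rightarrow> bool" where
  "left_congruence S \<rho> \<longleftrightarrow>
     equiv (carrier S) \<rho> \<and>
     (\<forall>s\<in>carrier S. \<forall>a b. (a, b) \<in> \<rho> \<longrightarrow> (s \<otimes>\<^bsub>S\<^esub> a, s \<otimes>\<^bsub>S\<^esub> b) \<in> \<rho>)"

definition left_congruence_generated ::
    "('a, 'b) monoid_scheme \<Rightarrow> ('a \<times> 'a) set \<Rightarrow> ('a \<times> 'a) set" where
  "left_congruence_generated S U = \<Inter>{\<rho>. left_congruence S \<rho> \<and> U \<subseteq> \<rho>}"

definition finite_universal_generating_sets ::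
    "('a, 'b) monoid_scheme \<Rightarrow> ('a \<times> 'a) set set" where
  "finite_universal_generating_sets S =
     {U. finite U \<and> U \<subseteq> carrier S \<times> carrier S \<and>
         left_congruence_generated S U = carrier S \<times> carrier S}"

definition universal_left_congruence_fg :: "('a, 'b) monoid_scheme \<Rightarrow> bool" where
  "universal_left_congruence_fg S \<longleftrightarrow> finite_universal_generating_sets S \<noteq> {}"

(* A left U-sequence a = s1 u1, s1 v1 = s2 u2, ..., sn vn = b is encoded by the list of
   its triples (si, ui, vi); its length is the length of the list. *)
fun left_sequence ::
    "('a, 'b) monoid_scheme \<Rightarrow> ('a \<times> 'a) set \<Rightarrow> 'a \<Rightarrow> ('a \<times> 'a \<times> 'a) list \<Rightarrow> 'a \<Rightarrow> bool" where
  "left_sequence S U a [] b \<longleftrightarrow> a = b"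
| "left_sequence S U a ((s, u, v) # ts) b \<longleftrightarrow>
     s \<in> carrier S \<and> ((u, v) \<in> U \<or> (v, u) \<in> U) \<and>
     a = s \<otimes>\<^bsub>S\<^esub> u \<and> left_sequence S U (s \<otimes>\<^bsub>S\<^esub> v) ts b"

(* In enat the infimum of a nonempty set is its minimum, and the infimum of the empty set
   is \<infinity>. So the distance is the least length of a sequence (\<infinity> if there is none), and the
   left diameter below is a minimum (\<infinity> if there is no finite generating set). *)
definition left_distance ::
    "('a, 'b) monoid_scheme \<Rightarrow> ('a \<times> 'a) set \<Rightarrow> 'a \<Rightarrow> 'a \<Rightarrow> enat" where
  "left_distance S U a b = (INF ts \<in> {ts. left_sequence S U a ts b}. enat (length ts))"

definition left_diameter_wrt ::
    "('a, 'b) monoid_scheme \<Rightarrow> ('a \<times> 'a) set \<Rightarrow> enat" where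
  "left_diameter_wrt S U = (SUP a \<in> carrier S. SUP b \<in> carrier S. left_distance S U a b)"

definition left_diameter :: "('a, 'b) monoid_scheme \<Rightarrow> enat" where
  "left_diameter S = (INF U \<in> finite_universal_generating_sets S. left_diameter_wrt S U)"

(* Maps act on the right, so the product of f and g applies f first. *)
definition End_chain :: "('c::linorder \<Rightarrow> 'c) monoid" where
  "End_chain = \<lparr>carrier = {f. mono f}, mult = (\<lambda>f g. g \<circ> f), one = id\<rparr>"

lemma monoid_End_chain: "monoid End_chain"
  by (unfold_locales) (auto simp: End_chain_def mono_def)

end

theory Submission
  imports Defs
begin

text \<open>
  Let \<open>k\<close> be any constant map. The single pair \<open>(id, k)\<close> already connects all endomorphisms in
  two steps: multiplying \<open>(id, k)\<close> by \<open>f\<close> on the left gives the pair \<open>(f, k)\<close>, because \<open>f\<close> followed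
  by a constant map is that constant map. Hence \<open>f\<close>, \<open>k\<close>, \<open>g\<close> are the nodes of a sequence of length
  two, and the left diameter is at most 2.

  For the lower bound, suppose a finite set \<open>U\<close> connects any two endomorphisms in at most one step,
  and consider only the constant maps. A step from the constant \<open>x\<close> to the constant \<open>y\<close> along
  \<open>(u, v)\<close> yields a point \<open>t\<close> with \<open>(x, y) = (u t, v t)\<close>. As \<open>u\<close> and \<open>v\<close> preserve the order, the
  points \<open>(u t, v t)\<close> form a chain in the product order of \<open>C \<times> C\<close>. So finitely many chains would
  cover all points off the diagonal. But an infinite \<open>C\<close> has arbitrarily large finite antichains off
  the diagonal, for instance the points \<open>(x\<^sub>i, x\<^bsub>n-i\<^esub>)\<close> given by an increasing sequence
  \<open>x\<^sub>0 < \<dots> < x\<^sub>n\<close> with \<open>n\<close> odd, and a chain contains at most one point of an antichain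
  (\<open>off_diagonal_not_covered_by_finitely_many_chains\<close>).
\<close>

section \<open>Left sequences and generating sets\<close>

lemma left_sequence_in_left_congruence:
  assumes "left_congruence S \<rho>" "U \<subseteq> \<rho>" "left_sequence S U a ts b" "b \<in> carrier S"
  shows "(a, b) \<in> \<rho>"
  using assms(3)
proof (induction ts arbitrary: a)
  case Nil
  then show ?case
    using assms(1,4) by (auto simp: left_congruence_def equiv_def refl_on_def)
next
  case (Cons t ts)
  obtain s u v where t: "t = (s, u, v)" by (cases t)
  have eq: "equiv (carrier S) \<rho>"
    using assms(1) by (simp add: left_congruence_def)
  have s: "s \<in> carrier S" and a: "a = s \<otimes>\<^bsub>S\<^esub> u" and rest: "left_sequence S U (s \<otimes>\<^bsub>S\<^esub> v) ts b"
    and uv: "(u, v) \<in> U \<or> (v, u) \<in> U"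
    using Cons.prems by (auto simp: t)
  have "(u, v) \<in> \<rho>"
    using uv assms(2) eq by (meson equiv_def subsetD symD)
  then have "(a, s \<otimes>\<^bsub>S\<^esub> v) \<in> \<rho>"
    using assms(1) s by (auto simp: left_congruence_def a)
  with Cons.IH[OF rest] show ?case
    using eq by (meson equiv_def transD)
qed

lemma (in monoid) left_congruence_universal:
  "left_congruence G (carrier G \<times> carrier G)"
  by (auto simp: left_congruence_def equiv_def refl_on_def sym_def trans_def)

lemma (in monoid) connected_imp_finite_universal_generating_set:
  assumes "finite U" "U \<subseteq> carrier G \<times> carrier G"
    and "\<And>a b. a \<in> carrier G \<Longrightarrow> b \<in> carrier G \<Longrightarrow> \<exists>ts. left_sequence G U a ts b"
  shows "U \<in> finite_universal_generating_sets G"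
proof -
  have "left_congruence_generated G U \<subseteq> carrier G \<times> carrier G"
    using left_congruence_universal assms(2) by (auto simp: left_congruence_generated_def)
  moreover have "carrier G \<times> carrier G \<subseteq> left_congruence_generated G U"
    using assms(3) left_sequence_in_left_congruence[of G]
    unfolding left_congruence_generated_def by blast
  ultimately show ?thesis
    using assms(1,2) by (auto simp: finite_universal_generating_sets_def)
qed

lemma left_diameter_wrt_le:
  assumes "\<And>a b. a \<in> carrier S \<Longrightarrow> b \<in> carrier S \<Longrightarrow>
             \<exists>ts. left_sequence S U a ts b \<and> length ts \<le> n"
  shows "left_diameter_wrt S U \<le> enat n"
  unfolding left_diameter_wrt_def left_distance_def
proof (intro SUP_least)
  fix a b assume "a \<in> carrier S" "b \<in> carrier S"
  then obtain ts where "left_sequence S U a ts b" "length ts \<le> n"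
    using assms by blast
  then show "(INF ts \<in> {ts. left_sequence S U a ts b}. enat (length ts)) \<le> enat n"
    by (intro INF_lower2[of ts]) auto
qed

lemma left_diameter_wrt_less_imp_sequence:
  assumes "left_diameter_wrt S U < enat n" "a \<in> carrier S" "b \<in> carrier S"
  shows "\<exists>ts. left_sequence S U a ts b \<and> length ts < n"
proof -
  have "left_distance S U a b \<le> left_diameter_wrt S U"
    unfolding left_diameter_wrt_def using assms(2,3) by (meson SUP_upper SUP_upper2)
  then have "left_distance S U a b < enat n"
    using assms(1) by (rule le_less_trans)
  then show ?thesis
    by (auto simp: left_distance_def INF_less_iff)
qed

section \<open>The upper bound\<close>

lemma carrier_End_chain [simp]: "f \<in> carrier End_chain \<longleftrightarrow> mono f"
  by (simp add: End_chain_def)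

lemma mult_End_chain [simp]: "f \<otimes>\<^bsub>End_chain\<^esub> g = g \<circ> f"
  by (simp add: End_chain_def)

text \<open>The sequence runs through the constant map, which absorbs every left factor.\<close>

lemma two_step_sequence_through_constant:
  assumes "mono f" "mono g"
  shows "left_sequence End_chain {(id, \<lambda>_. c)} f [(f, id, \<lambda>_. c), (g, \<lambda>_. c, id)] g"
  using assms by (simp add: comp_def)

lemma constant_generates_End_chain:
  fixes c :: "'c::linorder"
  shows "{(id, \<lambda>_. c)} \<in> finite_universal_generating_sets End_chain"
proof (rule monoid.connected_imp_finite_universal_generating_set[OF monoid_End_chain])
  show "{(id, \<lambda>_. c)} \<subseteq> carrier End_chain \<times> carrier End_chain"
    by (auto simp: mono_def)
  show "\<exists>ts. left_sequence End_chain {(id, \<lambda>_. c)} f ts g"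
    if "f \<in> carrier End_chain" "g \<in> carrier End_chain" for f g
    using that two_step_sequence_through_constant[of f g c] by (metis carrier_End_chain)
qed simp

lemma left_diameter_End_chain_le: "left_diameter (End_chain :: ('c::linorder \<Rightarrow> 'c) monoid) \<le> 2"
proof -
  \<comment> \<open>Any element serves as the value of the constant map; \<open>undefined\<close> names one.\<close>
  let ?U = "{(id, \<lambda>_. undefined)} :: (('c \<Rightarrow> 'c) \<times> ('c \<Rightarrow> 'c)) set"
  have "left_diameter (End_chain :: ('c \<Rightarrow> 'c) monoid) \<le> left_diameter_wrt End_chain ?U"
    unfolding left_diameter_def by (rule INF_lower[OF constant_generates_End_chain])
  also have "\<dots> \<le> enat 2"
  proof (rule left_diameter_wrt_le)
    fix f g :: "'c \<Rightarrow> 'c"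
    assume "f \<in> carrier End_chain" "g \<in> carrier End_chain"
    then have "left_sequence End_chain ?U f [(f, id, \<lambda>_. undefined), (g, \<lambda>_. undefined, id)] g"
      by (intro two_step_sequence_through_constant) auto
    then show "\<exists>ts. left_sequence End_chain ?U f ts g \<and> length ts \<le> 2"
      by (metis One_nat_def Suc_1 le_refl length_Cons list.size(3))
  qed
  finally show ?thesis
    by (simp add: numeral_eq_enat)
qed

section \<open>The lower bound\<close>

lemma infinite_chain_has_increasing_sequence:
  assumes "infinite (UNIV :: 'c::linorder set)"
  shows "\<exists>x :: nat \<Rightarrow> 'c. strict_mono_on {..<n} x"
proof -
  obtain A :: "'c set" where A: "finite A" "card A = n"
    using infinite_arbitrarily_large[OF assms] by blast
  then have "strict_mono_on {..<n} ((!) (sorted_list_of_set A))"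
    using sorted_list_of_set.strict_sorted_key_list_of_set[of A]
    by (auto simp: strict_mono_on_def sorted_wrt_iff_nth_less)
  then show ?thesis by blast
qed

text \<open>
  Each pair of monotone maps parametrises a chain of the product order. With \<open>m\<close> pairs, the \<open>m + 1\<close> points \<open>(x\<^sub>i, x\<^bsub>2m+1-i\<^esub>)\<close> with \<open>i \<le> m\<close> defeat a cover by
  pigeonhole: two of them would lie on one chain, although one coordinate rises while the other
  falls. They avoid the diagonal since \<open>i \<le> m < 2m + 1 - i\<close>.
\<close>

lemma off_diagonal_not_covered_by_finitely_many_chains:
  fixes V :: "(('a::linorder \<Rightarrow> 'c::linorder) \<times> ('a \<Rightarrow> 'c)) set"
  assumes "infinite (UNIV :: 'c set)" "finite V"
    and mono: "V \<subseteq> {u. mono u} \<times> {v. mono v}"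
  shows "\<exists>x y. x \<noteq> y \<and> (\<forall>p\<in>V. \<forall>t. (x, y) \<noteq> (fst p t, snd p t))"
proof (rule ccontr)
  assume "\<not> ?thesis"
  then have cover: "\<exists>p\<in>V. \<exists>t. fst p t = x \<and> snd p t = y" if "x \<noteq> y" for x y
    using that by (metis prod.inject)
  define m where "m = card V"
  obtain x :: "nat \<Rightarrow> 'c" where x: "strict_mono_on {..<2 * m + 2} x"
    using infinite_chain_has_increasing_sequence[OF assms(1)] by blast
  have less: "x i < x j" if "i < j" "j < 2 * m + 2" for i j
    using x that by (auto simp: strict_mono_on_def)
  have "\<exists>p\<in>V. \<exists>t. fst p t = x i \<and> snd p t = x (2 * m + 1 - i)" if "i \<le> m" for i
  proof (rule cover)
    have "x i < x (2 * m + 1 - i)"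
      using that by (intro less) auto
    then show "x i \<noteq> x (2 * m + 1 - i)" by simp
  qed
  then obtain p t where p: "p i \<in> V"
      and t: "fst (p i) (t i) = x i" "snd (p i) (t i) = x (2 * m + 1 - i)" if "i \<le> m" for i
    by metis
  have "card (p ` {..m}) \<le> card V"
    using p assms(2) by (intro card_mono) auto
  then have "\<not> inj_on p {..m}"
    by (intro pigeonhole) (simp add: m_def)
  then obtain i j where ij: "i < j" "j \<le> m" "p i = p j"
    unfolding inj_on_def by (metis atMost_iff linorder_neqE_nat)
  have mono_p: "mono (fst (p j))" "mono (snd (p j))"
    using mono p[of j] ij by auto
  have "fst (p j) (t i) < fst (p j) (t j)"
    using t(1)[of i] t(1)[of j] ij less[of i j] by simp
  then have "t i < t j"
    using mono_p(1) by (meson monoD not_le)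
  then have "snd (p j) (t i) \<le> snd (p j) (t j)"
    using mono_p(2) by (simp add: monoD)
  then show False
    using t(2)[of i] t(2)[of j] ij less[of "2 * m + 1 - j" "2 * m + 1 - i"]
    by (simp add: less_Suc_eq_le diff_less_mono2)
qed

text \<open>
  A sequence between distinct endomorphisms that is shorter than 2 consists of one step, and for
  constant maps that step can be evaluated at any point.
\<close>

lemma short_sequence_between_constants:
  assumes "left_sequence End_chain U (\<lambda>_. x) ts (\<lambda>_. y)" "length ts < 2" "x \<noteq> y"
  shows "\<exists>p\<in>U \<union> U\<inverse>. \<exists>t. (x, y) = (fst p t, snd p t)"
proof -
  have "ts \<noteq> []"
    using assms(1,3) by (auto dest: fun_cong)
  then obtain s u v where "ts = [(s, u, v)]"
    using assms(2) by (cases ts) (auto simp: length_Suc_conv)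
  then have uv: "(u, v) \<in> U \<union> U\<inverse>" and "(\<lambda>_. x) = u \<circ> s" "v \<circ> s = (\<lambda>_. y)"
    using assms(1) by auto
  then have "(x, y) = (u (s x), v (s x))"
    by (metis comp_apply)
  with uv show ?thesis by (intro bexI[of _ "(u, v)"]) auto
qed

lemma left_diameter_wrt_End_chain_ge:
  fixes U :: "(('c::linorder \<Rightarrow> 'c) \<times> ('c \<Rightarrow> 'c)) set"
  assumes "infinite (UNIV :: 'c set)" "finite U" "U \<subseteq> carrier End_chain \<times> carrier End_chain"
  shows "2 \<le> left_diameter_wrt End_chain U"
proof (rule ccontr)
  assume "\<not> ?thesis"
  then have short: "left_diameter_wrt End_chain U < enat 2"
    by (simp add: numeral_eq_enat)
  have mono: "U \<union> U\<inverse> \<subseteq> {u. mono u} \<times> {v. mono v}"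
    using assms(3) by auto
  have finite: "finite (U \<union> U\<inverse>)"
    using assms(2) by simp
  obtain x y where "x \<noteq> y"
      and avoid: "\<forall>p\<in>U \<union> U\<inverse>. \<forall>t. (x, y) \<noteq> (fst p t, snd p t)"
    using off_diagonal_not_covered_by_finitely_many_chains[OF assms(1) finite mono]
    by (elim exE conjE) (rule that)
  have "(\<lambda>_. z) \<in> carrier End_chain" for z :: 'c
    by (simp add: mono_def)
  then obtain ts where "left_sequence End_chain U (\<lambda>_. x) ts (\<lambda>_. y)" "length ts < 2"
    using left_diameter_wrt_less_imp_sequence[OF short, of "\<lambda>_. x" "\<lambda>_. y"] by metis
  from short_sequence_between_constants[OF this \<open>x \<noteq> y\<close>] avoid show False
    by (elim bexE exE) (drule (1) bspec, blast)
qed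

section \<open>The left diameter\<close>

theorem theorem1:
  assumes "infinite (UNIV :: 'c::linorder set)"
  shows "universal_left_congruence_fg (End_chain :: ('c \<Rightarrow> 'c) monoid) \<and>
         left_diameter (End_chain :: ('c \<Rightarrow> 'c) monoid) = 2"
proof
  show "universal_left_congruence_fg (End_chain :: ('c \<Rightarrow> 'c) monoid)"
    using constant_generates_End_chain by (auto simp: universal_left_congruence_fg_def)
  have "2 \<le> left_diameter (End_chain :: ('c \<Rightarrow> 'c) monoid)"
    unfolding left_diameter_def using left_diameter_wrt_End_chain_ge[OF assms]
    by (auto simp: finite_universal_generating_sets_def intro!: INF_greatest)
  with left_diameter_End_chain_le
  show "left_diameter (End_chain :: ('c \<Rightarrow> 'c) monoid) = 2"
    by (rule antisym)
qed

end
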